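(* Let $G$ be a weighted network with set of cells $C=\{1,\ldots,n\}$ and let $\Delta_{\mathcal P}$ be a non-null generalized polydiagonal subspace of $\mathbb{R}^n$, where $\mathcal P=\{P_1,\ldots,P_p,\overline P_1,\ldots,\overline P_q,P_0\}$ is a tagged partition of $C$ determined by $p,q,r$ (with $p>0$; $P_0$ is present exactly when $r=1$). Consider an enumeration of $C$ adapted to $\mathcal P$. Let $M$ be the adjacency matrix $W_G$ (respectively, the Laplacian matrix $L_G$) of $G$, and let $Q_{ij},R_{ij},\overline Q_{ij},\overline R_{ij},Z_{0j},\overline Z_{0j}$ be the blocks of $M$ with respect to $\mathcal P$. Then $M$ leaves $\Delta_{\mathcal P}$ invariant if and only if the following conditions hold. When $q>0$: (1) for $1\le i,j\le q$: $\mathrm{rs}(Q_{ij})-\mathrm{rs}(R_{ij})$ and $\mathrm{rs}(\overline Q_{ij})-\mathrm{rs}(\overline R_{ij})$ are regular of the same valency; (2) for $1\le i\le q$ and $q+1\le j\le p$: $\mathrm{rs}(Q_{ij})$ and $-\mathrm{rs}(\overline R_{ij})$ are regular of the same valency; (3) for $q+1\le i\le p$ and $1\le j\le q$: $\mathrm{rs}(Q_{ij})-\mathrm{rs}(R_{ij})$ is regular; (4) for $q+1\le i,j\le p$: $Q_{ij}$ is regular; (5) if $r=1$: $\mathrm{rs}(Z_{0j})=\mathrm{rs}(\overline Z_{0j})$ for $1\le j\le q$, and $\mathrm{rs}(Z_{0j})=0$ for $q+1\le j\le p$. When $q=0$: (1') for $1\le i,j\le p$: $Q_{ij}$ is regular;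 (2') if $r=1$: $\mathrm{rs}(Z_{0j})=0$ for $1\le j\le p$.
   Context: A weighted network $G$ with set of cells $C=\{1,\ldots,n\}$ is a directed graph with real edge weights. Its adjacency matrix is $W_G=[w_{ij}]\in\mathbb{R}^{n\times n}$, where $w_{ij}$ is the weight of the edge from cell $j$ to cell $i$ (zero if there is no such edge; self-loops allowed). The input valency of cell $i$ is $v(i)=\sum_{j\in C}w_{ij}$. The Laplacian matrix is $L_G=D_G-W_G$, where $D_G$ is the diagonal matrix with diagonal entries $v(1),\ldots,v(n)$. Tagged partition: let $p,q,r$ be nonnegative integers with $0\le q\le p\le n$, $r\in\{0,1\}$. A tagged partition $\mathcal P$ of $C$ determined by $p,q,r$ is a partition of $C$ into $p+q+r$ disjoint nonempty parts: $P_1,\ldots,P_p$; $\overline P_1,\ldots,\overline P_q$, where $\overline P_l$ is called the counterpart of $P_l$ (and $P_l$ the counterpart of $\overline P_l$); and, if $r=1$, a part $P_0$ called the zero part. The null partition is the one with $p=q=0$, $r=1$, $P_0=C$. The generalized polydiagonal subspace associated with $\mathcal P$ is $\Delta_{\mathcal P}=\{x\in\mathbb{R}^n: x_j=x_i$ if $j$ is in the same part as $i$; $x_j=-x_i$ if $j$ is in the counterpart of the part of $i$; $x_j=0$ if $j\in P_0\}$. It is non-null if $\mathcal P$ is not the null partition. A matrix $M$ leaves $\Delta$ invariant if $M\Delta\subseteq\Delta$. Blocks: for $A,B\subseteq C$ write $M[A,B]$ for the submatrix of $M$ with rows in $A$ and columns in $B$ (connections to $A$ from $B$). An enumeration of $C$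 is adapted to $\mathcal P$ if cells of the same part are consecutive, with the parts ordered $P_1,\ldots,P_p,\overline P_1,\ldots,\overline P_q,P_0$. The blocks are $Q_{ij}=M[P_i,P_j]$, $R_{ij}=M[P_i,\overline P_j]$, $Z_{i0}=M[P_i,P_0]$, $\overline R_{ij}=M[\overline P_i,P_j]$, $\overline Q_{ij}=M[\overline P_i,\overline P_j]$, $\overline Z_{i0}=M[\overline P_i,P_0]$, $Z_{0j}=M[P_0,P_j]$, $\overline Z_{0j}=M[P_0,\overline P_j]$, $Z_{00}=M[P_0,P_0]$. $\mathrm{rs}$ is the row sum operator: $\mathrm{rs}(B)$ is the column vector whose $i$-th entry is the sum of the entries of the $i$-th row of $B$. A (possibly rectangular) matrix or column vector is regular of valency $v$ if all its row sums equal $v$ (for a column vector: all entries equal $v$). Two column vectors that are regular of the same valency need not have the same length. *)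

theory Defs
  imports
    "HOL-Library.Disjoint_Sets"
    "Graph_Theory.Pair_Digraph"
    "Jordan_Normal_Form.DL_Submatrix"
begin

section \<open>Weighted networks\<close>

text \<open>
  Cells are numbered from 0, to match the indices of matrices: the set of cells is
  \<open>{..<n}\<close>. The arc \<open>(j, i)\<close> is the edge from cell \<open>j\<close> to cell \<open>i\<close>. Self-loops are allowed.
\<close>

definition weighted_network :: "nat \<Rightarrow> nat pair_pre_digraph \<Rightarrow> (nat \<times> nat \<Rightarrow> real) \<Rightarrow> bool" where
  "weighted_network n G w \<longleftrightarrow> pair_fin_digraph G \<and> pverts G = {..<n}"

definition adjacency_matrix :: "nat \<Rightarrow> nat pair_pre_digraph \<Rightarrow> (nat \<times> nat \<Rightarrow> real) \<Rightarrow> real mat" where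
  "adjacency_matrix n G w = mat n n (\<lambda>(i, j). if (j, i) \<in> parcs G then w (j, i) else 0)"

definition input_valency :: "nat \<Rightarrow> nat pair_pre_digraph \<Rightarrow> (nat \<times> nat \<Rightarrow> real) \<Rightarrow> nat \<Rightarrow> real" where
  "input_valency n G w i = (\<Sum>j<n. adjacency_matrix n G w $$ (i, j))"

definition laplacian_matrix :: "nat \<Rightarrow> nat pair_pre_digraph \<Rightarrow> (nat \<times> nat \<Rightarrow> real) \<Rightarrow> real mat" where
  "laplacian_matrix n G w = mat_diag n (input_valency n G w) - adjacency_matrix n G w"


section \<open>Tagged partitions and generalized polydiagonal subspaces\<close>

text \<open>
  \<open>Part l\<close>, \<open>Counterpart l\<close> and \<open>Zero\<close> are the tags of $P_l$, $\overline{P}_l$ and $P_0$.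
  A tagged partition is a family of cell sets indexed by tags; only its values on
  \<open>tags p q r\<close> matter.
\<close>

datatype tag = Part nat | Counterpart nat | Zero

definition tags :: "nat \<Rightarrow> nat \<Rightarrow> nat \<Rightarrow> tag set" where
  "tags p q r = Part ` {1..p} \<union> Counterpart ` {1..q} \<union> (if r = 1 then {Zero} else {})"

definition tagged_partition :: "nat \<Rightarrow> nat \<Rightarrow> nat \<Rightarrow> nat \<Rightarrow> (tag \<Rightarrow> nat set) \<Rightarrow> bool" where
  "tagged_partition n p q r P \<longleftrightarrow>
     q \<le> p \<and> p \<le> n \<and> r \<in> {0, 1} \<and>
     (\<forall>a\<in>tags p q r. P a \<noteq> {}) \<and>
     disjoint_family_on P (tags p q r) \<and>
     (\<Union>a\<in>tags p q r. P a) = {..<n}"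

definition null_partition :: "nat \<Rightarrow> nat \<Rightarrow> nat \<Rightarrow> nat \<Rightarrow> (tag \<Rightarrow> nat set) \<Rightarrow> bool" where
  "null_partition n p q r P \<longleftrightarrow> p = 0 \<and> q = 0 \<and> r = 1 \<and> P Zero = {..<n}"

definition polydiagonal :: "nat \<Rightarrow> nat \<Rightarrow> nat \<Rightarrow> nat \<Rightarrow> (tag \<Rightarrow> nat set) \<Rightarrow> real vec set" where
  "polydiagonal n p q r P = {x \<in> carrier_vec n.
     (\<forall>a\<in>tags p q r. \<forall>i\<in>P a. \<forall>j\<in>P a. x $ j = x $ i) \<and>
     (\<forall>l\<in>{1..q}. \<forall>i\<in>P (Part l). \<forall>j\<in>P (Counterpart l). x $ j = - x $ i) \<and>
     (r = 1 \<longrightarrow> (\<forall>j\<in>P Zero. x $ j = 0))}"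

definition leaves_invariant :: "real mat \<Rightarrow> real vec set \<Rightarrow> bool" where
  "leaves_invariant M \<Delta> \<longleftrightarrow> (\<lambda>x. M *\<^sub>v x) ` \<Delta> \<subseteq> \<Delta>"


section \<open>Adapted enumerations and blocks\<close>

text \<open>
  An enumeration \<open>e\<close> lists the cells as \<open>e 0, \<dots>, e (n - 1)\<close>. It is adapted if the position in
  the list $P_1, \ldots, P_p, \overline{P}_1, \ldots, \overline{P}_q, P_0$ of the part of \<open>e k\<close>
  is nondecreasing in \<open>k\<close>, which also makes the cells of each part consecutive.
\<close>

fun tag_position :: "nat \<Rightarrow> nat \<Rightarrow> tag \<Rightarrow> nat" where
  "tag_position p q (Part l) = l"
| "tag_position p q (Counterpart l) = p + l"
| "tag_position p q Zero = p + q + 1"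

definition adapted_enumeration ::
    "nat \<Rightarrow> nat \<Rightarrow> nat \<Rightarrow> nat \<Rightarrow> (tag \<Rightarrow> nat set) \<Rightarrow> (nat \<Rightarrow> nat) \<Rightarrow> bool" where
  "adapted_enumeration n p q r P e \<longleftrightarrow>
     bij_betw e {..<n} {..<n} \<and>
     (\<forall>k l a b. k < l \<longrightarrow> l < n \<longrightarrow> a \<in> tags p q r \<longrightarrow> b \<in> tags p q r \<longrightarrow>
        e k \<in> P a \<longrightarrow> e l \<in> P b \<longrightarrow> tag_position p q a \<le> tag_position p q b)"

text \<open>The matrix of \<open>M\<close> with respect to the enumeration \<open>e\<close>.\<close>

definition reindex :: "(nat \<Rightarrow> nat) \<Rightarrow> real mat \<Rightarrow> real mat" where
  "reindex e M = mat (dim_row M) (dim_col M) (\<lambda>(k, l). M $$ (e k, e l))"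

text \<open>
  The block $M[A, B]$, with the rows \<open>A\<close> and columns \<open>B\<close> listed in the order of \<open>e\<close>; the sets
  \<open>e -` A\<close> and \<open>e -` B\<close> consist of the places of these cells in the enumeration (\<open>submatrix\<close>
  ignores out-of-range indices).
\<close>

definition block :: "(nat \<Rightarrow> nat) \<Rightarrow> real mat \<Rightarrow> nat set \<Rightarrow> nat set \<Rightarrow> real mat" where
  "block e M A B = submatrix (reindex e M) (e -` A) (e -` B)"


section \<open>Row sums and regularity\<close>

definition rs :: "real mat \<Rightarrow> real vec" where
  "rs B = vec (dim_row B) (\<lambda>i. \<Sum>j<dim_col B. B $$ (i, j))"

definition regular_vec :: "real \<Rightarrow> real vec \<Rightarrow> bool" where
  "regular_vec v u \<longleftrightarrow> (\<forall>i<dim_vec u. u $ i = v)"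

definition regular_mat :: "real \<Rightarrow> real mat \<Rightarrow> bool" where
  "regular_mat v B \<longleftrightarrow> (\<forall>i<dim_row B. rs B $ i = v)"

end

(* A vector of the polydiagonal is the combination of the signed indicators
   1_(P_l) - 1_(P'_l) (l <= q) and 1_(P_l) (l > q), weighted by its common values on the P_l;
   P'_l is the counterpart of P_l. Hence M leaves the polydiagonal invariant iff it maps every
   signed indicator into it. The image of the l-th one has as i-th entry the sum of row i of M
   over P_l, minus for l <= q its sum over P'_l, so membership of these images, read off part by
   part, is the list of row sum conditions on the blocks. *)

theory Submission
  imports Defs
begin

section \<open>Places of cells in an enumeration and row sums of blocks\<close>

text \<open>An element \<open>i\<close> of \<open>I\<close> is picked at the index counting the
  smaller elements of \<open>I\<close>, so the image covers the whole set. As it has at most as many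
  elements, counting gives both equality and injectivity.\<close>

lemma bij_betw_pick:
  "bij_betw (pick I) {..<card {a. a < m \<and> a \<in> I}} {a. a < m \<and> a \<in> I}"
    (is "bij_betw _ {..<card ?S} _")
proof -
  have fin: "finite ?S" by simp
  have sub: "?S \<subseteq> pick I ` {..<card ?S}"
  proof
    fix i assume i: "i \<in> ?S"
    have "{a \<in> I. a < i} \<subset> ?S" using i by auto
    then have "card {a \<in> I. a < i} < card ?S" by (rule psubset_card_mono[OF fin])
    moreover have "pick I (card {a \<in> I. a < i}) = i" using i by (simp add: pick_card_in_set)
    ultimately show "i \<in> pick I ` {..<card ?S}"
      by (intro image_eqI[of _ _ "card {a \<in> I. a < i}"]) simp_all
  qed
  have le: "card (pick I ` {..<card ?S}) \<le> card ?S"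
    using card_image_le[of "{..<card ?S}" "pick I"] by simp
  have eq: "?S = pick I ` {..<card ?S}"
    by (rule card_seteq[OF _ sub le]) simp
  have "inj_on (pick I) {..<card ?S}"
    by (rule eq_card_imp_inj_on) (simp_all only: eq[symmetric] card_lessThan finite_lessThan)
  then show ?thesis by (rule bij_betw_imageI) (rule eq[symmetric])
qed

text \<open>The cell to which row \<open>k\<close> of a block \<open>M[A, B]\<close> belongs, whatever \<open>B\<close> is.\<close>

definition nth_cell :: "(nat \<Rightarrow> nat) \<Rightarrow> nat set \<Rightarrow> nat \<Rightarrow> nat" where
  "nth_cell e A k = e (pick (e -` A) k)"

text \<open>Nothing is known of \<open>e\<close> outside \<open>{..<n}\<close>, so the preimage of
  \<open>A\<close> may contain stray places; it has to be cut off at \<open>n\<close>.\<close>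

lemma bij_betw_places:
  assumes "bij_betw e {..<n} {..<n}" and "A \<subseteq> {..<n}"
  shows "bij_betw e {k. k < n \<and> k \<in> e -` A} A"
proof (rule bij_betw_subset[OF assms(1)])
  have "e ` {k. k < n \<and> k \<in> e -` A} = e ` {..<n} \<inter> A" by auto
  also have "\<dots> = A"
    unfolding bij_betw_imp_surj_on[OF assms(1)] using assms(2) by (rule Int_absorb1)
  finally show "e ` {k. k < n \<and> k \<in> e -` A} = A" .
qed auto

lemma card_places:
  assumes "bij_betw e {..<n} {..<n}" and "A \<subseteq> {..<n}"
  shows "card {k. k < n \<and> k \<in> e -` A} = card A"
  using bij_betw_places[OF assms] by (rule bij_betw_same_card)

lemma bij_betw_nth_cell:
  assumes "bij_betw e {..<n} {..<n}" and "A \<subseteq> {..<n}"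
  shows "bij_betw (nth_cell e A) {..<card A} A"
  using bij_betw_trans[OF bij_betw_pick[of "e -` A" n] bij_betw_places[OF assms]]
  unfolding card_places[OF assms] by (simp add: nth_cell_def[abs_def] comp_def)

text \<open>Along a row, \<open>nth_cell e B\<close> runs through each cell of \<open>B\<close>
  once, so the order of the columns disappears from the sum. Only the rows keep their places in the
  enumeration.\<close>

lemma rs_block:
  assumes M: "M \<in> carrier_mat n n" and e: "bij_betw e {..<n} {..<n}"
    and A: "A \<subseteq> {..<n}" and B: "B \<subseteq> {..<n}"
  shows "rs (block e M A B) = vec (card A) (\<lambda>k. \<Sum>j\<in>B. M $$ (nth_cell e A k, j))"
proof -
  have dims [simp]: "dim_row (reindex e M) = n" "dim_col (reindex e M) = n"
    using M by (simp_all add: reindex_def)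
  have rows: "dim_row (block e M A B) = card A"
    and cols: "dim_col (block e M A B) = card B"
    using card_places[OF e A] card_places[OF e B] by (simp_all add: block_def dim_submatrix)
  have entry: "block e M A B $$ (k, l) = M $$ (nth_cell e A k, nth_cell e B l)"
    if "k < card A" "l < card B" for k l
  proof -
    have "pick (e -` A) k < n" "pick (e -` B) l < n"
      using that card_places[OF e A] card_places[OF e B] by (auto intro!: pick_le)
    then show ?thesis
      using that card_places[OF e A] card_places[OF e B] M
      unfolding block_def by (subst submatrix_index) (auto simp: reindex_def nth_cell_def)
  qed
  have "(\<Sum>l<card B. M $$ (i, nth_cell e B l)) = (\<Sum>j\<in>B. M $$ (i, j))" for i
    by (rule sum.reindex_bij_betw[OF bij_betw_nth_cell[OF e B]])
  then have "rs (block e M A B) $ k = (\<Sum>j\<in>B. M $$ (nth_cell e A k, j))" if "k < card A" for k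
    using that by (simp add: rs_def rows cols entry)
  then show ?thesis
    by (intro eq_vecI) (simp_all add: rs_def rows)
qed

text \<open>Since \<open>nth_cell e A\<close> reaches every cell of \<open>A\<close>, a condition on
  all places becomes one on all cells. Vectors of different lengths, over a part and its
  counterpart, then become comparable.\<close>

lemma regular_vec_nth_cell:
  assumes "bij_betw e {..<n} {..<n}" and "A \<subseteq> {..<n}"
  shows "regular_vec v (vec (card A) (\<lambda>k. f (nth_cell e A k))) \<longleftrightarrow> (\<forall>i\<in>A. f i = v)"
  using bij_betw_imp_surj_on[OF bij_betw_nth_cell[OF assms]]
  by (force simp: regular_vec_def)

lemma vec_eq_nth_cell:
  assumes "bij_betw e {..<n} {..<n}" and "A \<subseteq> {..<n}"
  shows "vec (card A) (\<lambda>k. f (nth_cell e A k)) = vec (card A) (\<lambda>k. g (nth_cell e A k))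
    \<longleftrightarrow> (\<forall>i\<in>A. f i = g i)"
  using bij_betw_imp_surj_on[OF bij_betw_nth_cell[OF assms]]
  by (force simp: vec_eq_iff)

lemma regular_mat_eq_regular_vec_rs: "regular_mat v B \<longleftrightarrow> regular_vec v (rs B)"
  by (simp add: regular_mat_def regular_vec_def rs_def)

lemma vec_diff_eq: "vec m f - vec m g = vec m (\<lambda>k. f k - g k :: real)"
  by (intro eq_vecI) auto

lemma vec_uminus_eq: "- vec m f = vec m (\<lambda>k. - f k :: real)"
  by (intro eq_vecI) auto

section \<open>Signed indicators of the parts\<close>

text \<open>For \<open>l\<close> in \<open>{1..p}\<close> this is the scalar product of
  \<open>f\<close> with the \<open>l\<close>-th signed indicator. The guard \<open>l \<le> q\<close>
  matters because \<open>P (Counterpart l)\<close> is an arbitrary set for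
  \<open>l > q\<close>.\<close>

definition signed_sum :: "nat \<Rightarrow> (tag \<Rightarrow> nat set) \<Rightarrow> (nat \<Rightarrow> real) \<Rightarrow> nat \<Rightarrow> real" where
  "signed_sum q P f l =
     (\<Sum>j\<in>P (Part l). f j) - (if l \<le> q then \<Sum>j\<in>P (Counterpart l). f j else 0)"

definition signed_indicator :: "nat \<Rightarrow> nat \<Rightarrow> (tag \<Rightarrow> nat set) \<Rightarrow> nat \<Rightarrow> real vec" where
  "signed_indicator n q P l =
     vec n (\<lambda>j. if j \<in> P (Part l) then 1 else if l \<le> q \<and> j \<in> P (Counterpart l) then - 1 else 0)"

lemma mem_tags [simp]:
  "Part l \<in> tags p q r \<longleftrightarrow> l \<in> {1..p}"
  "Counterpart l \<in> tags p q r \<longleftrightarrow> l \<in> {1..q}"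
  "Zero \<in> tags p q r \<longleftrightarrow> r = 1"
  by (auto simp: tags_def)

lemma finite_tags: "finite (tags p q r)"
  by (simp add: tags_def)

section \<open>Polydiagonal subspace of a fixed tagged partition\<close>

context
  fixes n p q r :: nat and P :: "tag \<Rightarrow> nat set"
  assumes partition: "tagged_partition n p q r P"
begin

lemma part_subset: "a \<in> tags p q r \<Longrightarrow> P a \<subseteq> {..<n}"
  using partition by (auto simp: tagged_partition_def)

lemma part_nonempty: "a \<in> tags p q r \<Longrightarrow> P a \<noteq> {}"
  using partition by (auto simp: tagged_partition_def)

lemma part_unique: "a \<in> tags p q r \<Longrightarrow> b \<in> tags p q r \<Longrightarrow> i \<in> P a \<Longrightarrow> i \<in> P b \<Longrightarrow> a = b"
  using partition by (auto simp: tagged_partition_def disjoint_family_on_def)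

lemma q_le_p: "q \<le> p"
  using partition by (simp add: tagged_partition_def)

lemma sum_cells:
  fixes f :: "nat \<Rightarrow> real"
  shows "(\<Sum>j<n. f j) = (\<Sum>l\<in>{1..p}. \<Sum>j\<in>P (Part l). f j)
    + (\<Sum>l\<in>{1..q}. \<Sum>j\<in>P (Counterpart l). f j) + (if r = 1 then \<Sum>j\<in>P Zero. f j else 0)"
proof -
  have "(\<Sum>j<n. f j) = (\<Sum>j\<in>(\<Union>a\<in>tags p q r. P a). f j)"
    using partition by (simp add: tagged_partition_def)
  also have "\<dots> = (\<Sum>a\<in>tags p q r. \<Sum>j\<in>P a. f j)"
  proof (rule sum.UNION_disjoint[OF finite_tags])
    show "\<forall>a\<in>tags p q r. finite (P a)"
      using part_subset finite_subset by blast
    show "\<forall>a\<in>tags p q r. \<forall>b\<in>tags p q r. a \<noteq> b \<longrightarrow> P a \<inter> P b = {}"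
      using part_unique by blast
  qed
  also have "\<dots> = (\<Sum>a\<in>Part ` {1..p}. \<Sum>j\<in>P a. f j) + (\<Sum>a\<in>Counterpart ` {1..q}. \<Sum>j\<in>P a. f j)
      + (\<Sum>a\<in>(if r = 1 then {Zero} else {}). \<Sum>j\<in>P a. f j)"
    unfolding tags_def by (subst sum.union_disjoint, auto)+
  also have "\<dots> = (\<Sum>l\<in>{1..p}. \<Sum>j\<in>P (Part l). f j)
    + (\<Sum>l\<in>{1..q}. \<Sum>j\<in>P (Counterpart l). f j) + (if r = 1 then \<Sum>j\<in>P Zero. f j else 0)"
    by (simp add: sum.reindex inj_on_def)
  finally show ?thesis .
qed

text \<open>Replaces the pairwise equations between entries by coordinates: \<open>y l\<close> is
  the common value on the \<open>l\<close>-th part. Such values exist because the parts are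
  nonempty.\<close>

lemma polydiagonal_iff:
  "x \<in> polydiagonal n p q r P \<longleftrightarrow> x \<in> carrier_vec n \<and> (\<exists>y.
     (\<forall>l\<in>{1..p}. \<forall>i\<in>P (Part l). x $ i = y l) \<and>
     (\<forall>l\<in>{1..q}. \<forall>i\<in>P (Counterpart l). x $ i = - y l) \<and>
     (r = 1 \<longrightarrow> (\<forall>i\<in>P Zero. x $ i = 0)))" (is "_ \<longleftrightarrow> _ \<and> (\<exists>y. ?C y)")
proof
  assume x: "x \<in> polydiagonal n p q r P"
  define y where "y l = x $ (SOME i. i \<in> P (Part l))" for l
  have some: "(SOME i. i \<in> P (Part l)) \<in> P (Part l)" if "l \<in> {1..p}" for l
    using part_nonempty[of "Part l"] that by (auto intro: someI_ex)
  have "?C y"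
  proof (intro conjI ballI impI)
    show "x $ i = y l" if "l \<in> {1..p}" "i \<in> P (Part l)" for l i
    proof -
      have "\<forall>i\<in>P (Part l). \<forall>j\<in>P (Part l). x $ j = x $ i"
        using x that(1) unfolding polydiagonal_def by (blast intro: mem_tags(1)[THEN iffD2])
      with some[OF that(1)] that(2) show ?thesis unfolding y_def by blast
    qed
    show "x $ i = - y l" if "l \<in> {1..q}" "i \<in> P (Counterpart l)" for l i
      using x some[of l] that q_le_p by (auto simp: polydiagonal_def y_def)
    show "x $ i = 0" if "r = 1" "i \<in> P Zero" for i
      using x that by (auto simp: polydiagonal_def)
  qed
  with x show "x \<in> carrier_vec n \<and> (\<exists>y. ?C y)"
    by (auto simp: polydiagonal_def)
next
  assume "x \<in> carrier_vec n \<and> (\<exists>y. ?C y)"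
  then obtain y where x: "x \<in> carrier_vec n" and y: "?C y" by blast
  have "x $ j = x $ i" if "a \<in> tags p q r" "i \<in> P a" "j \<in> P a" for a i j
    using that y by (cases a) auto
  moreover have "x $ j = - x $ i"
    if "l \<in> {1..q}" "i \<in> P (Part l)" "j \<in> P (Counterpart l)" for l i j
  proof -
    have "l \<in> {1..p}" using that(1) q_le_p by auto
    then have "x $ i = y l" using that(2) y by blast
    moreover have "x $ j = - y l" using that(1,3) y by blast
    ultimately show ?thesis by simp
  qed
  ultimately show "x \<in> polydiagonal n p q r P"
    using x y unfolding polydiagonal_def by blast
qed

text \<open>The values \<open>y l\<close> can be chosen separately for each \<open>l\<close>, which
  brings membership into the shape of the regularity conditions: one valency shared by a part and,
  after a change of sign, its counterpart, and one for each part without counterpart.\<close>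

lemma vec_in_polydiagonal_iff:
  "vec n f \<in> polydiagonal n p q r P \<longleftrightarrow>
     (\<forall>l\<in>{1..q}. \<exists>v. (\<forall>i\<in>P (Part l). f i = v) \<and> (\<forall>i\<in>P (Counterpart l). - f i = v)) \<and>
     (\<forall>l\<in>{q+1..p}. \<exists>v. \<forall>i\<in>P (Part l). f i = v) \<and>
     (r = 1 \<longrightarrow> (\<forall>i\<in>P Zero. f i = 0))" (is "_ \<longleftrightarrow> ?R")
proof -
  have entry: "vec n f $ i = f i" if "a \<in> tags p q r" "i \<in> P a" for a i
    using part_subset[OF that(1)] that(2) by auto
  have "vec n f \<in> polydiagonal n p q r P \<longleftrightarrow> (\<exists>y.
     (\<forall>l\<in>{1..p}. \<forall>i\<in>P (Part l). f i = y l) \<and>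
     (\<forall>l\<in>{1..q}. \<forall>i\<in>P (Counterpart l). f i = - y l) \<and>
     (r = 1 \<longrightarrow> (\<forall>i\<in>P Zero. f i = 0)))"
    unfolding polydiagonal_iff
    using entry[of "Part _"] entry[of "Counterpart _"] entry[of Zero] by simp
  also have "\<dots> \<longleftrightarrow> ?R"
  proof
    assume "\<exists>y. (\<forall>l\<in>{1..p}. \<forall>i\<in>P (Part l). f i = y l) \<and>
      (\<forall>l\<in>{1..q}. \<forall>i\<in>P (Counterpart l). f i = - y l) \<and> (r = 1 \<longrightarrow> (\<forall>i\<in>P Zero. f i = 0))"
    then obtain y where "\<forall>l\<in>{1..p}. \<forall>i\<in>P (Part l). f i = y l"
      "\<forall>l\<in>{1..q}. \<forall>i\<in>P (Counterpart l). f i = - y l" "r = 1 \<longrightarrow> (\<forall>i\<in>P Zero. f i = 0)"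
      by blast
    then show ?R
      using q_le_p by (intro conjI ballI exI[of _ "y _"]) auto
  next
    assume R: ?R
    obtain y where y: "\<And>l. l \<in> {1..q} \<Longrightarrow>
        (\<forall>i\<in>P (Part l). f i = y l) \<and> (\<forall>i\<in>P (Counterpart l). - f i = y l)"
      using R by metis
    obtain z where z: "\<And>l. l \<in> {q+1..p} \<Longrightarrow> \<forall>i\<in>P (Part l). f i = z l"
      using R by metis
    show "\<exists>y. (\<forall>l\<in>{1..p}. \<forall>i\<in>P (Part l). f i = y l) \<and>
      (\<forall>l\<in>{1..q}. \<forall>i\<in>P (Counterpart l). f i = - y l) \<and> (r = 1 \<longrightarrow> (\<forall>i\<in>P Zero. f i = 0))"
    \<comment> \<open>The two families of valencies are glued at \<open>q\<close>, since the
      coordinates form a single function on \<open>{1..p}\<close>.\<close>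
    proof (rule exI[of _ "\<lambda>l. if l \<le> q then y l else z l"], intro conjI ballI)
      fix l i assume "l \<in> {1..p}" "i \<in> P (Part l)"
      then show "f i = (if l \<le> q then y l else z l)" using y[of l] z[of l] by auto
    next
      fix l i assume "l \<in> {1..q}" "i \<in> P (Counterpart l)"
      then show "f i = - (if l \<le> q then y l else z l)" using y[of l] by fastforce
    qed (use R in simp)
  qed
  finally show ?thesis .
qed

text \<open>This is the expansion of \<open>x\<close> in the signed indicators, tested against
  \<open>f\<close>: split the sum over the cells by parts and pull out the constant values
  \<open>y l\<close>, \<open>- y l\<close> and 0.\<close>

lemma sum_mult_polydiagonal:
  assumes "\<forall>l\<in>{1..p}. \<forall>i\<in>P (Part l). x $ i = y l"
    and "\<forall>l\<in>{1..q}. \<forall>i\<in>P (Counterpart l). x $ i = - y l"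
    and "r = 1 \<longrightarrow> (\<forall>i\<in>P Zero. x $ i = 0)"
  shows "(\<Sum>j<n. f j * x $ j) = (\<Sum>l\<in>{1..p}. y l * signed_sum q P f l)"
proof -
  have "(\<Sum>l\<in>{1..q}. \<Sum>j\<in>P (Counterpart l). f j * x $ j)
      = (\<Sum>l\<in>{1..q}. - (y l * (\<Sum>j\<in>P (Counterpart l). f j)))"
    using assms(2) by (auto simp: sum_distrib_left mult.commute simp flip: sum_negf intro!: sum.cong)
  \<comment> \<open>Padding with zeros up to \<open>p\<close> lets this sum be added termwise to the
    one over the parts.\<close>
  also have "\<dots> = (\<Sum>l\<in>{1..p}. if l \<le> q then - (y l * (\<Sum>j\<in>P (Counterpart l). f j)) else 0)"
    using q_le_p by (intro sum.mono_neutral_cong_left) auto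
  finally have "(\<Sum>l\<in>{1..q}. \<Sum>j\<in>P (Counterpart l). f j * x $ j) = \<dots>" .
  moreover have "(\<Sum>l\<in>{1..p}. \<Sum>j\<in>P (Part l). f j * x $ j)
      = (\<Sum>l\<in>{1..p}. y l * (\<Sum>j\<in>P (Part l). f j))"
    using assms(1) by (auto simp: sum_distrib_left mult.commute intro!: sum.cong)
  moreover have "(if r = 1 then \<Sum>j\<in>P Zero. f j * x $ j else 0) = 0"
    using assms(3) by simp
  ultimately have "(\<Sum>j<n. f j * x $ j) = (\<Sum>l\<in>{1..p}. y l * (\<Sum>j\<in>P (Part l). f j))
      + (\<Sum>l\<in>{1..p}. if l \<le> q then - (y l * (\<Sum>j\<in>P (Counterpart l). f j)) else 0)"
    unfolding sum_cells by simp
  also have "\<dots> = (\<Sum>l\<in>{1..p}. y l * signed_sum q P f l)"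
    by (auto simp: signed_sum_def right_diff_distrib simp flip: sum.distrib intro!: sum.cong)
  finally show ?thesis .
qed

text \<open>The coordinates of the \<open>l\<close>-th indicator are a Kronecker delta, by
  disjointness of the parts. The three claims have the form of the hypotheses of
  \<open>sum_mult_polydiagonal\<close>.\<close>

lemma signed_indicator_values:
  assumes "l \<in> {1..p}"
  shows "\<forall>m\<in>{1..p}. \<forall>i\<in>P (Part m). signed_indicator n q P l $ i = (if m = l then 1 else 0)"
    and "\<forall>m\<in>{1..q}. \<forall>i\<in>P (Counterpart m).
      signed_indicator n q P l $ i = - (if m = l then 1 else 0)"
    and "r = 1 \<longrightarrow> (\<forall>i\<in>P Zero. signed_indicator n q P l $ i = 0)"
proof -
  have entry: "signed_indicator n q P l $ i =
      (if a = Part l then 1 else if l \<le> q \<and> a = Counterpart l then - 1 else 0)"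
    if a: "a \<in> tags p q r" and i: "i \<in> P a" for a i
  proof -
    have "i < n" using part_subset[OF a] i by auto
    moreover have "i \<in> P (Part l) \<longleftrightarrow> a = Part l"
      using part_unique[OF a, of "Part l" i] i assms by auto
    moreover have "l \<le> q \<Longrightarrow> i \<in> P (Counterpart l) \<longleftrightarrow> a = Counterpart l"
      using part_unique[OF a, of "Counterpart l" i] i assms by auto
    ultimately show ?thesis by (auto simp: signed_indicator_def)
  qed
  show "\<forall>m\<in>{1..p}. \<forall>i\<in>P (Part m). signed_indicator n q P l $ i = (if m = l then 1 else 0)"
    using entry[of "Part _"] by simp
  show "\<forall>m\<in>{1..q}. \<forall>i\<in>P (Counterpart m).
      signed_indicator n q P l $ i = - (if m = l then 1 else 0)"
    using entry[of "Counterpart _"] by simp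
  show "r = 1 \<longrightarrow> (\<forall>i\<in>P Zero. signed_indicator n q P l $ i = 0)"
    using entry[of Zero] by simp
qed

lemma signed_indicator_in_polydiagonal:
  assumes "l \<in> {1..p}"
  shows "signed_indicator n q P l \<in> polydiagonal n p q r P"
  unfolding polydiagonal_iff
proof (intro conjI exI[of _ "\<lambda>m. if m = l then 1 else 0"])
  show "signed_indicator n q P l \<in> carrier_vec n" by (simp add: signed_indicator_def)
qed (fact signed_indicator_values[OF assms])+

text \<open>The equations defining the polydiagonal are linear and homogeneous, so they pass to
  linear combinations.\<close>

lemma sum_in_polydiagonal:
  assumes "\<And>l. l \<in> S \<Longrightarrow> vec n (f l) \<in> polydiagonal n p q r P"
  shows "vec n (\<lambda>i. \<Sum>l\<in>S. y l * f l i) \<in> polydiagonal n p q r P"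
proof -
  have entry: "vec n g $ i = g i" if "a \<in> tags p q r" "i \<in> P a" for a i and g :: "nat \<Rightarrow> real"
    using part_subset[OF that(1)] that(2) by auto
  have f: "f l j = f l i" if "l \<in> S" "a \<in> tags p q r" "i \<in> P a" "j \<in> P a" for l a i j
  proof -
    have "vec n (f l) $ j = vec n (f l) $ i"
      using assms[OF that(1)] that(2-4) unfolding polydiagonal_def by blast
    then show ?thesis using that(2-4) by (simp only: entry)
  qed
  have f': "f l j = - f l i"
    if "l \<in> S" "k \<in> {1..q}" "i \<in> P (Part k)" "j \<in> P (Counterpart k)" for l k i j
  proof -
    have "vec n (f l) $ j = - vec n (f l) $ i"
      using assms[OF that(1)] that(2-4) unfolding polydiagonal_def by blast
    then show ?thesis
      using that(2-4) q_le_p by (simp add: entry[of "Part k"] entry[of "Counterpart k"])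
  qed
  have f0: "f l j = 0" if "l \<in> S" "r = 1" "j \<in> P Zero" for l j
  proof -
    have "vec n (f l) $ j = 0"
      using assms[OF that(1)] that(2-3) unfolding polydiagonal_def by blast
    then show ?thesis using that(2-3) by (simp add: entry[of Zero])
  qed
  show ?thesis
    unfolding polydiagonal_def mem_Collect_eq
  proof (intro conjI ballI impI)
    fix a i j assume a: "a \<in> tags p q r" "i \<in> P a" "j \<in> P a"
    then have "(\<Sum>l\<in>S. y l * f l j) = (\<Sum>l\<in>S. y l * f l i)"
      using f[OF _ a] by simp
    with a show "vec n (\<lambda>i. \<Sum>l\<in>S. y l * f l i) $ j = vec n (\<lambda>i. \<Sum>l\<in>S. y l * f l i) $ i"
      by (simp add: entry)
  next
    fix k i j assume k: "k \<in> {1..q}" "i \<in> P (Part k)" "j \<in> P (Counterpart k)"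
    then have "(\<Sum>l\<in>S. y l * f l j) = - (\<Sum>l\<in>S. y l * f l i)"
      using f' by (auto simp flip: sum_negf intro!: sum.cong)
    then show "vec n (\<lambda>i. \<Sum>l\<in>S. y l * f l i) $ j = - vec n (\<lambda>i. \<Sum>l\<in>S. y l * f l i) $ i"
      using k q_le_p by (simp add: entry[of "Part k"] entry[of "Counterpart k"])
  next
    fix j assume "r = 1" "j \<in> P Zero"
    then show "vec n (\<lambda>i. \<Sum>l\<in>S. y l * f l i) $ j = 0"
      using f0 by (simp add: entry[of Zero])
  qed simp
qed

text \<open>The vector on the right is the image of the \<open>l\<close>-th signed indicator.
  Invariance applies to these indicators as members of the polydiagonal; conversely, the image of
  any member is a linear combination of their images.\<close>

lemma leaves_invariant_iff:
  assumes M: "M \<in> carrier_mat n n"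
  shows "leaves_invariant M (polydiagonal n p q r P) \<longleftrightarrow>
    (\<forall>l\<in>{1..p}. vec n (\<lambda>i. signed_sum q P (\<lambda>j. M $$ (i, j)) l) \<in> polydiagonal n p q r P)"
proof -
  have mult: "M *\<^sub>v x = vec n (\<lambda>i. \<Sum>l\<in>{1..p}. y l * signed_sum q P (\<lambda>j. M $$ (i, j)) l)"
    if "x \<in> carrier_vec n" and "\<forall>l\<in>{1..p}. \<forall>i\<in>P (Part l). x $ i = y l"
      and "\<forall>l\<in>{1..q}. \<forall>i\<in>P (Counterpart l). x $ i = - y l"
      and "r = 1 \<longrightarrow> (\<forall>i\<in>P Zero. x $ i = 0)" for x y
  proof (rule eq_vecI)
    fix i assume "i < dim_vec (vec n (\<lambda>i. \<Sum>l\<in>{1..p}. y l * signed_sum q P (\<lambda>j. M $$ (i, j)) l))"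
    then have i: "i < n" by simp
    then have "(M *\<^sub>v x) $ i = (\<Sum>j<n. M $$ (i, j) * x $ j)"
      using M that(1) by (auto simp: scalar_prod_def lessThan_atLeast0 intro!: sum.cong)
    then show "(M *\<^sub>v x) $ i
        = vec n (\<lambda>i. \<Sum>l\<in>{1..p}. y l * signed_sum q P (\<lambda>j. M $$ (i, j)) l) $ i"
      using sum_mult_polydiagonal[OF that(2-4)] i by simp
  qed (use M in auto)
  show ?thesis
  proof
    assume inv: "leaves_invariant M (polydiagonal n p q r P)"
    show "\<forall>l\<in>{1..p}. vec n (\<lambda>i. signed_sum q P (\<lambda>j. M $$ (i, j)) l) \<in> polydiagonal n p q r P"
    proof
      fix l assume l: "l \<in> {1..p}"
      have "M *\<^sub>v signed_indicator n q P l = vec n (\<lambda>i. signed_sum q P (\<lambda>j. M $$ (i, j)) l)"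
        \<comment> \<open>With Kronecker delta coordinates, the sum given by \<open>mult\<close>
          collapses to the term at \<open>l\<close>.\<close>
        using l by (subst mult[OF _ signed_indicator_values[OF l]])
          (simp_all add: signed_indicator_def if_distrib[of "\<lambda>c. c * _"] cong: if_cong)
      moreover have "M *\<^sub>v signed_indicator n q P l \<in> polydiagonal n p q r P"
        using inv signed_indicator_in_polydiagonal[OF l] by (auto simp: leaves_invariant_def)
      ultimately show "vec n (\<lambda>i. signed_sum q P (\<lambda>j. M $$ (i, j)) l) \<in> polydiagonal n p q r P"
        by simp
    qed
  next
    assume cols: "\<forall>l\<in>{1..p}. vec n (\<lambda>i. signed_sum q P (\<lambda>j. M $$ (i, j)) l)
      \<in> polydiagonal n p q r P"
    show "leaves_invariant M (polydiagonal n p q r P)"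
      unfolding leaves_invariant_def
    proof (rule image_subsetI)
      fix x assume "x \<in> polydiagonal n p q r P"
      then obtain y where "x \<in> carrier_vec n" "\<forall>l\<in>{1..p}. \<forall>i\<in>P (Part l). x $ i = y l"
        "\<forall>l\<in>{1..q}. \<forall>i\<in>P (Counterpart l). x $ i = - y l" "r = 1 \<longrightarrow> (\<forall>i\<in>P Zero. x $ i = 0)"
        unfolding polydiagonal_iff by blast
      from mult[OF this] show "M *\<^sub>v x \<in> polydiagonal n p q r P"
        using sum_in_polydiagonal[of "{1..p}"] cols by simp
    qed
  qed
qed

end


section \<open>Invariance as row sum conditions on the blocks\<close>

theorem proposition4p4:
  fixes n p q r :: nat
    and G :: "nat pair_pre_digraph" and w :: "nat \<times> nat \<Rightarrow> real"
    and P :: "tag \<Rightarrow> nat set" and e :: "nat \<Rightarrow> nat"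
    and M :: "real mat"
    and Q R Q' R' :: "nat \<Rightarrow> nat \<Rightarrow> real mat" and Z0 Z0' :: "nat \<Rightarrow> real mat"
  assumes network: "weighted_network n G w"
    and partition: "tagged_partition n p q r P"
    and non_null: "\<not> null_partition n p q r P" and p_pos: "p > 0"
    and enumeration: "adapted_enumeration n p q r P e"
    and M: "M = adjacency_matrix n G w \<or> M = laplacian_matrix n G w"
    and Q: "\<And>i j. Q i j = block e M (P (Part i)) (P (Part j))"
    and R: "\<And>i j. R i j = block e M (P (Part i)) (P (Counterpart j))"
    and R': "\<And>i j. R' i j = block e M (P (Counterpart i)) (P (Part j))"
    and Q': "\<And>i j. Q' i j = block e M (P (Counterpart i)) (P (Counterpart j))"
    and Z0: "\<And>j. Z0 j = block e M (P Zero) (P (Part j))"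
    and Z0': "\<And>j. Z0' j = block e M (P Zero) (P (Counterpart j))"
  shows "leaves_invariant M (polydiagonal n p q r P) \<longleftrightarrow>
    (q > 0 \<longrightarrow>
       (\<forall>i\<in>{1..q}. \<forall>j\<in>{1..q}. \<exists>v.
          regular_vec v (rs (Q i j) - rs (R i j)) \<and> regular_vec v (rs (Q' i j) - rs (R' i j))) \<and>
       (\<forall>i\<in>{1..q}. \<forall>j\<in>{q+1..p}. \<exists>v.
          regular_vec v (rs (Q i j)) \<and> regular_vec v (- rs (R' i j))) \<and>
       (\<forall>i\<in>{q+1..p}. \<forall>j\<in>{1..q}. \<exists>v. regular_vec v (rs (Q i j) - rs (R i j))) \<and>
       (\<forall>i\<in>{q+1..p}. \<forall>j\<in>{q+1..p}. \<exists>v. regular_mat v (Q i j)) \<and>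
       (r = 1 \<longrightarrow>
          (\<forall>j\<in>{1..q}. rs (Z0 j) = rs (Z0' j)) \<and>
          (\<forall>j\<in>{q+1..p}. rs (Z0 j) = 0\<^sub>v (card (P Zero))))) \<and>
    (q = 0 \<longrightarrow>
       (\<forall>i\<in>{1..p}. \<forall>j\<in>{1..p}. \<exists>v. regular_mat v (Q i j)) \<and>
       (r = 1 \<longrightarrow> (\<forall>j\<in>{1..p}. rs (Z0 j) = 0\<^sub>v (card (P Zero)))))"
proof -
  have e: "bij_betw e {..<n} {..<n}"
    using enumeration by (simp add: adapted_enumeration_def)
  have Mc: "M \<in> carrier_mat n n"
    using M by (auto simp: adjacency_matrix_def laplacian_matrix_def mat_diag_def)
  have qp: "q \<le> p" by (rule q_le_p[OF partition])
  note sub = part_subset[OF partition]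
  define T where "T B i = (\<Sum>j\<in>B. M $$ (i, j))" for B i
  have block: "rs (block e M (P a) (P b)) = vec (card (P a)) (\<lambda>k. T (P b) (nth_cell e (P a) k))"
    if "a \<in> tags p q r" "b \<in> tags p q r" for a b
    using rs_block[OF Mc e sub[OF that(1)] sub[OF that(2)]] by (simp add: T_def)
  note reg = regular_vec_nth_cell[OF e sub]
  \<comment> \<open>\<open>s l i\<close> is entry \<open>i\<close> of the image of the
    \<open>l\<close>-th signed indicator, written below through the row sums
    \<open>T\<close>.\<close>
  define s where "s l i = signed_sum q P (\<lambda>j. M $$ (i, j)) l" for l i
  have s: "s l i = (if l \<le> q then T (P (Part l)) i - T (P (Counterpart l)) i
      else T (P (Part l)) i)" for l i
    by (simp add: s_def signed_sum_def T_def)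
  \<comment> \<open>In the translations \<open>c1\<close> to \<open>c4\<close> the column index
    \<open>j\<close> selects the indicator and the row index \<open>i\<close> the part where its
    image is tested. On the counterpart of part \<open>i\<close> the value must be
    \<open>- v\<close>, hence the exchanged order in \<open>Q'\<close> minus
    \<open>R'\<close>.\<close>
  have c1: "regular_vec v (rs (Q i j) - rs (R i j)) \<and> regular_vec v (rs (Q' i j) - rs (R' i j))
      \<longleftrightarrow> (\<forall>k\<in>P (Part i). s j k = v) \<and> (\<forall>k\<in>P (Counterpart i). - s j k = v)"
    if "i \<in> {1..q}" "j \<in> {1..q}" for i j v
    using that qp
    by (simp add: Q R Q' R' block vec_diff_eq
        reg[of "Part i" v "\<lambda>k. T (P (Part j)) k - T (P (Counterpart j)) k"]
        reg[of "Counterpart i" v "\<lambda>k. T (P (Counterpart j)) k - T (P (Part j)) k"] s)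
  have c2: "regular_vec v (rs (Q i j)) \<and> regular_vec v (- rs (R' i j))
      \<longleftrightarrow> (\<forall>k\<in>P (Part i). s j k = v) \<and> (\<forall>k\<in>P (Counterpart i). - s j k = v)"
    if "i \<in> {1..q}" "j \<in> {q+1..p}" for i j v
    using that qp
    by (simp add: Q R' block vec_uminus_eq reg[of "Part i" v "T (P (Part j))"]
        reg[of "Counterpart i" v "\<lambda>k. - T (P (Part j)) k"] s)
  have c3: "regular_vec v (rs (Q i j) - rs (R i j)) \<longleftrightarrow> (\<forall>k\<in>P (Part i). s j k = v)"
    if "i \<in> {q+1..p}" "j \<in> {1..q}" for i j v
    using that qp
    by (simp add: Q R block vec_diff_eq
        reg[of "Part i" v "\<lambda>k. T (P (Part j)) k - T (P (Counterpart j)) k"] s)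
  have c4: "regular_mat v (Q i j) \<longleftrightarrow> (\<forall>k\<in>P (Part i). s j k = v)"
    if "i \<in> {q+1..p}" "j \<in> {q+1..p}" for i j v
    using that qp
    by (simp add: Q block regular_mat_eq_regular_vec_rs
        reg[of "Part i" v "T (P (Part j))"] s)
  have c5: "rs (Z0 j) = rs (Z0' j) \<longleftrightarrow> (\<forall>k\<in>P Zero. s j k = 0)" if "r = 1" "j \<in> {1..q}" for j
    using that qp
    by (simp add: Z0 Z0' block vec_eq_nth_cell[OF e sub[of Zero]] s)
  have c6: "rs (Z0 j) = 0\<^sub>v (card (P Zero)) \<longleftrightarrow> (\<forall>k\<in>P Zero. s j k = 0)"
    if "r = 1" "j \<in> {q+1..p}" for j
    using that qp vec_eq_nth_cell[OF e sub[of Zero], of "T (P (Part j))" "\<lambda>_. 0"]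
    by (simp add: Z0 block zero_vec_def s)
  \<comment> \<open>Separates the indicators with a negative part from those without.\<close>
  have split: "(\<forall>j\<in>{1..p}. F j) \<longleftrightarrow> (\<forall>j\<in>{1..q}. F j) \<and> (\<forall>j\<in>{q+1..p}. F j)" for F
  proof -
    have "{1..p} = {1..q} \<union> {q+1..p}" using qp by auto
    then show ?thesis by blast
  qed
  have "leaves_invariant M (polydiagonal n p q r P) \<longleftrightarrow>
       (\<forall>i\<in>{1..q}. \<forall>j\<in>{1..q}. \<exists>v.
          regular_vec v (rs (Q i j) - rs (R i j)) \<and> regular_vec v (rs (Q' i j) - rs (R' i j))) \<and>
       (\<forall>i\<in>{1..q}. \<forall>j\<in>{q+1..p}. \<exists>v.
          regular_vec v (rs (Q i j)) \<and> regular_vec v (- rs (R' i j))) \<and>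
       (\<forall>i\<in>{q+1..p}. \<forall>j\<in>{1..q}. \<exists>v. regular_vec v (rs (Q i j) - rs (R i j))) \<and>
       (\<forall>i\<in>{q+1..p}. \<forall>j\<in>{q+1..p}. \<exists>v. regular_mat v (Q i j)) \<and>
       (r = 1 \<longrightarrow>
          (\<forall>j\<in>{1..q}. rs (Z0 j) = rs (Z0' j)) \<and>
          (\<forall>j\<in>{q+1..p}. rs (Z0 j) = 0\<^sub>v (card (P Zero))))" (is "_ \<longleftrightarrow> ?general")
    unfolding leaves_invariant_iff[OF partition Mc] s_def[symmetric]
      vec_in_polydiagonal_iff[OF partition] split
    \<comment> \<open>The congruence rules supply the index ranges and \<open>r = 1\<close>, on
      which the translations depend. What remains is to regroup the quantifiers: invariance runs
      over \<open>j\<close> first, the conditions over \<open>i\<close>.\<close>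
    by (simp only: c1 c2 c3 c4 c5 c6 cong: ball_cong imp_cong conj_cong) blast
  \<comment> \<open>For \<open>q = 0\<close> the range \<open>{1..q}\<close> is empty and
    \<open>{q+1..p}\<close> is all of \<open>{1..p}\<close>, so only the conditions on parts without
    counterpart survive.\<close>
  moreover have "?general \<longleftrightarrow> (\<forall>i\<in>{1..p}. \<forall>j\<in>{1..p}. \<exists>v. regular_mat v (Q i j)) \<and>
      (r = 1 \<longrightarrow> (\<forall>j\<in>{1..p}. rs (Z0 j) = 0\<^sub>v (card (P Zero))))" if "q = 0"
    using that by simp
  ultimately show ?thesis by (cases "q = 0") simp_all
qed

end
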